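(* For a sequence $(G_n)_{n=1}^{\infty}$ of finite simple graphs, if $\chi(G_n) \to \infty$, then $\operatorname{cc}(L(G_n)) \to \infty$.
   Context: $\chi(G)$ is the chromatic number of $G$. The line graph $L(G)$ of $G$ has vertex set $E(G)$, two vertices being adjacent iff the corresponding edges share an endpoint. A chordal graph is a graph with no induced cycle of length more than three. The chordal covering number $\operatorname{cc}(H)$ of a graph $H$ is the minimum number of chordal graphs whose union is $H$. *)

theory Defs
  imports Complex_Main
begin

text \<open>
  Undirected graphs are given by a vertex set and a set of two-element vertex sets, so that
  the edges of a graph can themselves serve as the vertices of its line graph.
\<close>

record 'a ugraph =
  verts :: "'a set"
  edges :: "'a set set"

definition simple_graph :: "'a ugraph \<Rightarrow> bool" where
  "simple_graph G \<longleftrightarrow> (\<forall>e\<in>edges G. e \<subseteq> verts G \<and> card e = 2)"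

definition finite_simple_graph :: "'a ugraph \<Rightarrow> bool" where
  "finite_simple_graph G \<longleftrightarrow> simple_graph G \<and> finite (verts G)"

definition proper_colouring :: "'a ugraph \<Rightarrow> nat \<Rightarrow> ('a \<Rightarrow> nat) \<Rightarrow> bool" where
  "proper_colouring G k f \<longleftrightarrow>
     f ` verts G \<subseteq> {..<k} \<and> (\<forall>u v. {u, v} \<in> edges G \<longrightarrow> f u \<noteq> f v)"

definition chromatic_number :: "'a ugraph \<Rightarrow> nat" where
  "chromatic_number G = (LEAST k. \<exists>f. proper_colouring G k f)"

definition line_graph :: "'a ugraph \<Rightarrow> 'a set ugraph" where
  "line_graph G = \<lparr>verts = edges G,
     edges = {{e, f} |e f. e \<in> edges G \<and> f \<in> edges G \<and> e \<noteq> f \<and> e \<inter> f \<noteq> {}}\<rparr>"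

definition induced_subgraph :: "'a ugraph \<Rightarrow> 'a set \<Rightarrow> 'a ugraph" where
  "induced_subgraph G W = \<lparr>verts = W, edges = {e \<in> edges G. e \<subseteq> W}\<rparr>"

text \<open>
  The cycle that visits the entries of a list in order and returns to the first one.
  It is used for distinct lists of length at least three only.
\<close>

definition cycle_on :: "'a list \<Rightarrow> 'a ugraph" where
  "cycle_on xs = \<lparr>verts = set xs,
     edges = {{xs ! i, xs ! (Suc i mod length xs)} |i. i < length xs}\<rparr>"

definition chordal :: "'a ugraph \<Rightarrow> bool" where
  "chordal G \<longleftrightarrow> simple_graph G \<and>
     \<not> (\<exists>xs. distinct xs \<and> length xs > 3 \<and> set xs \<subseteq> verts G \<and>
            induced_subgraph G (set xs) = cycle_on xs)"

definition graph_Union :: "'a ugraph set \<Rightarrow> 'a ugraph" where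
  "graph_Union \<C> = \<lparr>verts = (\<Union>C\<in>\<C>. verts C), edges = (\<Union>C\<in>\<C>. edges C)\<rparr>"

definition chordal_cover :: "'a ugraph \<Rightarrow> 'a ugraph set \<Rightarrow> bool" where
  "chordal_cover H \<C> \<longleftrightarrow> (\<forall>C\<in>\<C>. chordal C) \<and> graph_Union \<C> = H"

definition chordal_covering_number :: "'a ugraph \<Rightarrow> nat" where
  "chordal_covering_number H = (LEAST k. \<exists>\<C>. finite \<C> \<and> card \<C> = k \<and> chordal_cover H \<C>)"

text \<open>On finite simple graphs both minima range over nonempty sets.\<close>

lemma finite_edges:
  assumes "finite_simple_graph G"
  shows "finite (edges G)"
  using assms unfolding finite_simple_graph_def simple_graph_def
  by (intro finite_subset[of "edges G" "Pow (verts G)"]) auto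

lemma chromatic_number_attained:
  assumes "finite_simple_graph G"
  shows "\<exists>f. proper_colouring G (chromatic_number G) f"
proof -
  have G: "simple_graph G" "finite (verts G)"
    using assms by (auto simp: finite_simple_graph_def)
  from \<open>finite (verts G)\<close> obtain f where
    f: "bij_betw f (verts G) {0..<card (verts G)}"
    using ex_bij_betw_finite_nat by blast
  have "f u \<noteq> f v" if e: "{u, v} \<in> edges G" for u v
  proof -
    have "{u, v} \<subseteq> verts G" "card {u, v} = 2"
      using G(1) e by (auto simp: simple_graph_def)
    then have "u \<in> verts G" "v \<in> verts G" "u \<noteq> v" by auto
    then show ?thesis using f by (auto simp: bij_betw_def inj_on_def)
  qed
  moreover have "f ` verts G \<subseteq> {..<card (verts G)}"
    using f by (auto simp: bij_betw_def)
  ultimately have "\<exists>f. proper_colouring G (card (verts G)) f"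
    by (auto simp: proper_colouring_def)
  then show ?thesis
    unfolding chromatic_number_def by (rule LeastI)
qed

lemma chordal_if_card_le_3:
  assumes "simple_graph G" "finite (verts G)" "card (verts G) \<le> 3"
  shows "chordal G"
proof -
  have "\<not> (distinct xs \<and> length xs > 3 \<and> set xs \<subseteq> verts G)" for xs
    using assms(2,3) card_mono[of "verts G" "set xs"] distinct_card[of xs] by auto
  then show ?thesis using assms(1) by (auto simp: chordal_def)
qed

lemma chordal_covering_number_attained:
  assumes "finite_simple_graph H"
  shows "\<exists>\<C>. finite \<C> \<and> card \<C> = chordal_covering_number H \<and> chordal_cover H \<C>"
proof -
  have H: "finite (verts H)" "\<And>e. e \<in> edges H \<Longrightarrow> e \<subseteq> verts H \<and> card e = 2"
    using assms by (auto simp: finite_simple_graph_def simple_graph_def)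
  define \<C> where "\<C> = (\<lambda>v. \<lparr>verts = {v}, edges = {}\<rparr>) ` verts H
    \<union> (\<lambda>e. \<lparr>verts = e, edges = {e}\<rparr>) ` edges H"
  have "finite \<C>"
    unfolding \<C>_def using H(1) finite_edges[OF assms] by blast
  moreover have "chordal C" if C: "C \<in> \<C>" for C
  proof (rule chordal_if_card_le_3)
    consider v where "C = \<lparr>verts = {v}, edges = {}\<rparr>"
      | e where "e \<in> edges H" "C = \<lparr>verts = e, edges = {e}\<rparr>"
      using C by (auto simp: \<C>_def)
    then have "simple_graph C \<and> finite (verts C) \<and> card (verts C) \<le> 3"
    proof cases
      case 1
      then show ?thesis by (simp add: simple_graph_def)
    next
      case 2
      then have "finite e" "card e = 2"
        using H(2)[of e] card_ge_0_finite[of e] by auto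
      with 2 show ?thesis by (simp add: simple_graph_def)
    qed
    then show "simple_graph C" "finite (verts C)" "card (verts C) \<le> 3" by auto
  qed
  moreover have "graph_Union \<C> = H"
  proof (rule ugraph.equality)
    show "verts (graph_Union \<C>) = verts H"
      using H(2) by (fastforce simp: graph_Union_def \<C>_def)
    show "edges (graph_Union \<C>) = edges H"
      by (auto simp: graph_Union_def \<C>_def)
  qed auto
  ultimately have "\<exists>\<C>'. finite \<C>' \<and> card \<C>' = card \<C> \<and> chordal_cover H \<C>'"
    by (auto simp: chordal_cover_def)
  then show ?thesis
    unfolding chordal_covering_number_def by (rule LeastI)
qed

lemma finite_simple_line_graph:
  assumes "finite_simple_graph G"
  shows "finite_simple_graph (line_graph G)"
  using finite_edges[OF assms]
  by (auto simp: finite_simple_graph_def simple_graph_def line_graph_def card_2_iff)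

end

theory Submission
  imports Defs
begin

text \<open>
  Suppose that chordal graphs \<open>C\<^sub>1, \<dots>, C\<^sub>k\<close> cover the line graph of \<open>G\<close>. In a perfect elimination
  ordering of \<open>C\<^sub>i\<close> the later neighbours of an edge \<open>e\<close> form a clique of the line graph, so all but at
  most one of them pass through a single endpoint of \<open>e\<close>; orient \<open>e\<close> towards that endpoint. An edge at
  a vertex \<open>v\<close> thus has a type, the set of those \<open>i\<close> for which it is oriented into \<open>v\<close>, and its types
  at its two endpoints are complementary. If an edge \<open>a\<close> at \<open>v\<close> has type \<open>S\<close>, then it has at most two
  later neighbours of the complementary type at \<open>v\<close> in each \<open>C\<^sub>i\<close>. Since every two edges at \<open>v\<close> are
  adjacent in some \<open>C\<^sub>i\<close>, double counting shows that \<open>S\<close> and its complement cannot both occur more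
  than \<open>4k\<close> times at \<open>v\<close>. Colour \<open>v\<close> by the set of its frequent types: this is proper on the edges
  whose types are frequent at both ends, and the remaining edges form a graph of bounded degeneracy.
\<close>

section \<open>Induced paths, simplicial vertices and perfect elimination in chordal graphs\<close>

text \<open>A shortest path works: a repeated vertex or a forward chord would allow a shortcut.
  \<open>R\<close> may be asymmetric, so only chords from an earlier to a later position are
  excluded.\<close>

lemma rtranclp_induced_path:
  assumes "R\<^sup>*\<^sup>* x y"
  obtains p where "p \<noteq> []" "hd p = x" "last p = y" "successively R p" "distinct p"
    "\<And>i j. Suc i < j \<Longrightarrow> j < length p \<Longrightarrow> \<not> R (p ! i) (p ! j)"
proof -
  define P where "P p \<longleftrightarrow> p \<noteq> [] \<and> hd p = x \<and> last p = y \<and> successively R p" for p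
  have "\<exists>p. p \<noteq> [] \<and> hd p = x \<and> last p = y \<and> successively R p"
    using assms
  proof (induction rule: rtranclp_induct)
    case base
    show ?case by (intro exI[of _ "[x]"]) auto
  next
    case (step y z)
    then obtain p where "p \<noteq> []" "hd p = x" "last p = y" "successively R p"
      by blast
    then show ?case using step(2)
      by (intro exI[of _ "p @ [z]"]) (auto simp: successively_append_iff)
  qed
  then have "\<exists>p. P p" by (simp add: P_def)
  then obtain p where p: "P p" and least: "\<And>q. P q \<Longrightarrow> length p \<le> length q"
    using ex_has_least_nat[of P _ length] by blast
  have "distinct p"
  proof (rule ccontr)
    assume "\<not> distinct p"
    then obtain as bs cs a where d: "p = as @ [a] @ bs @ [a] @ cs"
      using not_distinct_decomp by blast
    then have "P (as @ [a] @ cs)"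
      using p by (cases as; cases cs) (auto simp: P_def successively_append_iff successively_Cons hd_append split: if_splits)
    then show False using least d by fastforce
  qed
  moreover have "\<not> R (p ! i) (p ! j)" if ij: "Suc i < j" "j < length p" for i j
  proof
    assume R: "R (p ! i) (p ! j)"
    have "successively R (take (Suc i) p @ drop (Suc i) p)" "successively R (take j p @ drop j p)"
      using p by (auto simp: P_def)
    then have "successively R (take (Suc i) p)" "successively R (drop j p)"
      unfolding successively_append_iff by auto
    moreover have "last (take (Suc i) p) = p ! i" "hd (drop j p) = p ! j"
      using ij by (auto simp: take_Suc_conv_app_nth hd_drop_conv_nth)
    ultimately have "P (take (Suc i) p @ drop j p)"
      using p R ij by (auto simp: P_def successively_append_iff)
    then show False using least[of "take (Suc i) p @ drop j p"] ij by auto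
  qed
  ultimately show thesis using p that by (auto simp: P_def)
qed

text \<open>Otherwise an induced path from \<open>x\<close> to \<open>x'\<close> with inner vertices
  in \<open>W\<close> closes through \<open>y\<close> to an induced cycle: \<open>y\<close> sees the
  two ends of the path and nothing of \<open>W\<close>.\<close>

lemma chordal_adjacentI:
  assumes C: "chordal C" and V: "W \<subseteq> verts C" "x \<in> verts C" "x' \<in> verts C" "y \<in> verts C"
    and ne: "x \<noteq> x'"
    and y: "{x, y} \<in> edges C" "{x', y} \<in> edges C" "y \<notin> W" "\<And>w. w \<in> W \<Longrightarrow> {w, y} \<notin> edges C"
    and path: "(\<lambda>u v. {u, v} \<in> edges C \<and> u \<in> insert x (insert x' W) \<and> v \<in> insert x (insert x' W))\<^sup>*\<^sup>* x x'"
      (is "?R\<^sup>*\<^sup>* _ _")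
  shows "{x, x'} \<in> edges C"
proof (rule ccontr)
  assume nadj: "{x, x'} \<notin> edges C"
  have card2: "card e = 2" if "e \<in> edges C" for e
    using C that by (auto simp: chordal_def simple_graph_def)
  then have yx: "y \<noteq> x" "y \<noteq> x'" using y(1,2) by fastforce+
  obtain p where p: "p \<noteq> []" "hd p = x" "last p = x'" "successively ?R p" "distinct p"
    and chordless: "\<And>i j. Suc i < j \<Longrightarrow> j < length p \<Longrightarrow> \<not> ?R (p ! i) (p ! j)"
    using rtranclp_induced_path[OF path] by blast
  define n where "n = length p"
  have step: "?R (p ! i) (p ! Suc i)" if "Suc i < n" for i
    using p(4) that by (auto simp: successively_conv_nth n_def)
  have p0: "p ! 0 = x" using p by (simp add: hd_conv_nth)
  have pl: "p ! (n - 1) = x'" using p by (simp add: last_conv_nth n_def)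
  have "n > 0" using p by (simp add: n_def)
  \<comment> \<open>One vertex would force \<open>x = x'\<close>, two would make them adjacent. With
    at least three, adding \<open>y\<close> gives a cycle of length at least four.\<close>
  have "n \<noteq> 1" using p0 pl ne by auto
  moreover have "n \<noteq> 2" using step[of 0] p0 pl nadj by auto
  ultimately have n: "n \<ge> 3" using \<open>n > 0\<close> by linarith
  have in_Z: "p ! i \<in> insert x (insert x' W)" if "i < n" for i
    using that step[of "i - 1"] p0 by (cases i) auto
  then have set_p: "set p \<subseteq> insert x (insert x' W)"
    by (metis in_set_conv_nth n_def subsetI)
  have y_adj: "i = 0 \<or> i = n - 1" if "i < n" "{p ! i, y} \<in> edges C" for i
  proof -
    have "p ! i = x \<or> p ! i = x'" using in_Z[OF that(1)] y(4) that(2) by auto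
    moreover have "p ! i = x \<longleftrightarrow> i = 0" "p ! i = x' \<longleftrightarrow> i = n - 1"
      using that(1) p(1,5) n nth_eq_iff_index_eq[of p i 0] nth_eq_iff_index_eq[of p i "n - 1"]
      unfolding p0[symmetric] pl[symmetric] n_def by simp_all
    ultimately show ?thesis by blast
  qed
  \<comment> \<open>\<open>y\<close> takes position \<open>n\<close>, so the edge that wraps around
    modulo \<open>Suc n\<close> joins \<open>y\<close> to \<open>x\<close>.\<close>
  define xs where "xs = p @ [y]"
  have len: "length xs = Suc n" by (simp add: xs_def n_def)
  have nth: "xs ! i = (if i < n then p ! i else y)" if "i \<le> n" for i
    using that by (auto simp: xs_def n_def nth_append)
  have "edges (induced_subgraph C (set xs)) = edges (cycle_on xs)" (is "?A = ?B")
  proof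
    show "?B \<subseteq> ?A"
    proof
      fix e assume "e \<in> ?B"
      then obtain i where "i < Suc n" and ei: "e = {xs ! i, xs ! (Suc i mod Suc n)}"
        by (auto simp: cycle_on_def len)
      then have i: "i \<le> n" "e = {xs ! i, xs ! (Suc i mod Suc n)}" by simp_all
      then have "e \<subseteq> set xs" by (auto simp: len intro!: nth_mem)
      moreover consider "Suc i < n" | "Suc i = n" | "i = n" using i by linarith
      then have "e \<in> edges C"
      proof cases
        case 1
        then show ?thesis using i nth[of i] nth[of "Suc i"] step[of i] by simp
      next
        case 2
        then have "e = {x', y}" using i nth[of i] nth[of n] pl by auto
        then show ?thesis using y by simp
      next
        case 3
        then have "e = {x, y}" using i nth[of n] nth[of 0] p0 n by auto
        then show ?thesis using y by simp
      qed
      ultimately show "e \<in> ?A" by (simp add: induced_subgraph_def)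
    qed
    show "?A \<subseteq> ?B"
    proof
      fix e assume "e \<in> ?A"
      then have e: "e \<in> edges C" "e \<subseteq> set xs" by (auto simp: induced_subgraph_def)
      obtain a b where ab: "e = {a, b}" "a \<noteq> b" using card2[OF e(1)] by (auto simp: card_2_iff)
      \<comment> \<open>An edge at \<open>y\<close> ends at the first or last vertex of the path by
        \<open>y_adj\<close>; any other edge joins consecutive vertices, since the path has no
        chords.\<close>
      have main: "\<exists>l\<le>n. e = {xs ! l, xs ! (Suc l mod Suc n)}"
        if ij: "i < j" "j \<le> n" "e = {xs ! i, xs ! j}" for i j
      proof (cases "j = n")
        case True
        then have "e = {p ! i, y}" using ij nth by simp
        with y_adj[of i] e(1) ij True have "i = 0 \<or> i = n - 1" by auto
        then show ?thesis
        proof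
          assume "i = 0"
          then show ?thesis using True ij by (intro exI[of _ n]) auto
        next
          assume "i = n - 1"
          then show ?thesis using True ij n by (intro exI[of _ i]) auto
        qed
      next
        case False
        then have "e = {p ! i, p ! j}" using ij nth by simp
        then have "?R (p ! i) (p ! j)" using e(1) in_Z[of i] in_Z[of j] ij False by simp
        then have "\<not> Suc i < j" using chordless[of i j] ij False unfolding n_def by linarith
        then have "j = Suc i" using ij(1) by linarith
        then show ?thesis using ij False by (intro exI[of _ i]) auto
      qed
      obtain i j where "i \<le> n" "j \<le> n" "a = xs ! i" "b = xs ! j"
        using e(2) ab by (auto simp: in_set_conv_nth len less_Suc_eq_le)
      with main[of i j] main[of j i] ab have "\<exists>l\<le>n. e = {xs ! l, xs ! (Suc l mod Suc n)}"
        by (metis insert_commute linorder_neqE_nat)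
      then show "e \<in> ?B" by (auto simp: cycle_on_def len less_Suc_eq_le)
    qed
  qed
  then have "induced_subgraph C (set xs) = cycle_on xs"
    by (simp add: induced_subgraph_def cycle_on_def)
  moreover have "distinct xs" using p(5) set_p y(3) yx by (auto simp: xs_def)
  moreover have "set xs \<subseteq> verts C" using set_p V by (auto simp: xs_def)
  moreover have "length xs > 3" using len n by simp
  ultimately show False using C unfolding chordal_def by blast
qed

text \<open>Dirac's theorem, stated for a vertex subset \<open>U\<close> of a fixed
  \<open>C\<close>, so that the induction can shrink \<open>U\<close> without showing that induced
  subgraphs are chordal.\<close>

lemma chordal_simplicial_vertex:
  assumes C: "chordal C" and "finite U" "U \<noteq> {}" "U \<subseteq> verts C"
  shows "\<exists>s\<in>U. \<forall>a\<in>U. \<forall>b\<in>U. {s, a} \<in> edges C \<longrightarrow> {s, b} \<in> edges C \<longrightarrow> a \<noteq> b \<longrightarrow> {a, b} \<in> edges C"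
  using assms(2-)
proof (induction "card U" arbitrary: U rule: less_induct)
  case less
  define adj where "adj u v \<longleftrightarrow> {u, v} \<in> edges C" for u v
  define conn where "conn W \<longleftrightarrow> (\<forall>a\<in>W. \<forall>b\<in>W. (\<lambda>u v. adj u v \<and> u \<in> W \<and> v \<in> W)\<^sup>*\<^sup>* a b)" for W
  define far where "far W = {y \<in> U - W. \<forall>w\<in>W. \<not> adj w y}" for W
  have sym: "adj u v \<longleftrightarrow> adj v u" for u v by (simp add: adj_def insert_commute)
  define \<W> where "\<W> = {W. W \<subseteq> U \<and> W \<noteq> {} \<and> conn W \<and> far W \<noteq> {}}"
  show ?case
  proof (cases "\<exists>v\<in>U. far {v} \<noteq> {}")
    case False
    then have "adj a b" if "a \<in> U" "b \<in> U" "a \<noteq> b" for a b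
      using that by (auto simp: far_def)
    then show ?thesis using less(3) unfolding adj_def by blast
  next
    case True
    then have "\<W> \<noteq> {}" by (auto simp: \<W>_def conn_def)
    moreover have "finite \<W>"
      using less(2) by (auto simp: \<W>_def intro: finite_subset[of _ "Pow U"])
    ultimately obtain W where W: "W \<in> \<W>" and max: "\<And>W'. W' \<in> \<W> \<Longrightarrow> W \<subseteq> W' \<Longrightarrow> W' = W"
      using finite_has_maximal[of \<W>] by metis
    \<comment> \<open>By maximality the neighbourhood \<open>X\<close> of \<open>W\<close> is completely joined to \<open>Y\<close>, and it is a clique, since
      otherwise a path through \<open>W\<close> and a vertex of \<open>Y\<close> close an induced cycle. Hence a simplicial
      vertex of \<open>Y\<close> remains simplicial in \<open>U\<close>.\<close>
    define Y where "Y = far W"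
    define X where "X = U - W - Y"
    have W': "W \<subseteq> U" "W \<noteq> {}" "conn W" and Y: "Y \<noteq> {}" "Y \<subseteq> U" "Y \<inter> W = {}"
      using W by (auto simp: \<W>_def Y_def far_def)
    have XW: "\<exists>w\<in>W. adj w x" if "x \<in> X" for x
      using that by (auto simp: X_def Y_def far_def)
    have XY: "adj x y" if x: "x \<in> X" and y: "y \<in> Y" for x y
    proof -
      let ?W = "insert x W"
      let ?R = "\<lambda>u v. adj u v \<and> u \<in> ?W \<and> v \<in> ?W"
      obtain w where w: "w \<in> W" "adj w x" using XW[OF x] by blast
      have WW: "?R\<^sup>*\<^sup>* a b" if "a \<in> W" "b \<in> W" for a b
      proof -
        have "(\<lambda>u v. adj u v \<and> u \<in> W \<and> v \<in> W)\<^sup>*\<^sup>* a b"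
          using W'(3) that by (auto simp: conn_def)
        then show ?thesis by (rule rtranclp_mono[THEN predicate2D, rotated]) auto
      qed
      have "?R w x" "?R x w" using w sym by auto
      then have "?R\<^sup>*\<^sup>* a x" "?R\<^sup>*\<^sup>* x a" if "a \<in> W" for a
        using WW[OF that w(1)] WW[OF w(1) that]
        by (blast intro: rtranclp.rtrancl_into_rtrancl[of ?R] converse_rtranclp_into_rtranclp[of ?R])+
      \<comment> \<open>\<open>?W\<close> is connected and strictly larger than \<open>W\<close>, so
        maximality leaves no vertex far from it. As \<open>y\<close> has no neighbour in
        \<open>W\<close>, it must be adjacent to \<open>x\<close>.\<close>
      then have "conn ?W" using WW by (auto simp: conn_def)
      moreover have "?W \<notin> \<W>" using max[of ?W] x by (auto simp: X_def)
      ultimately have "far ?W = {}" using x W' by (auto simp: \<W>_def X_def)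
      then show ?thesis using x y by (auto simp: far_def X_def Y_def)
    qed
    have XX: "adj x x'" if x: "x \<in> X" "x' \<in> X" "x \<noteq> x'" for x x'
    proof -
      obtain y where y: "y \<in> Y" using Y by blast
      let ?Z = "insert x (insert x' W)"
      let ?R = "\<lambda>u v. {u, v} \<in> edges C \<and> u \<in> ?Z \<and> v \<in> ?Z"
      obtain w w' where w: "w \<in> W" "adj w x" "w' \<in> W" "adj w' x'"
        using XW x by meson
      have "(\<lambda>u v. adj u v \<and> u \<in> W \<and> v \<in> W)\<^sup>*\<^sup>* w w'"
        using W'(3) w by (auto simp: conn_def)
      then have "?R\<^sup>*\<^sup>* w w'" 
        by (rule rtranclp_mono[THEN predicate2D, rotated]) (auto simp: adj_def)
      moreover have "?R x w" "?R w' x'" using w sym[of x w] by (auto simp: adj_def)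
      ultimately have "?R\<^sup>*\<^sup>* x x'"
        using converse_rtranclp_into_rtranclp[of ?R x w w'] rtranclp.rtrancl_into_rtrancl[of ?R x w' x'] by blast
      moreover have "y \<notin> W" "\<And>w. w \<in> W \<Longrightarrow> {w, y} \<notin> edges C"
        using y by (auto simp: Y_def far_def adj_def)
      moreover have "{x, y} \<in> edges C" "{x', y} \<in> edges C"
        using XY x y by (auto simp: adj_def)
      ultimately show ?thesis
        unfolding adj_def using W'(1) x y Y less(4)
        by (intro chordal_adjacentI[OF C, of W x x' y]) (auto simp: X_def)
    qed
    have "card Y < card U" using W' Y less(2) by (intro psubset_card_mono) auto
    then obtain s where s: "s \<in> Y" and simp_s: "\<And>a b. a \<in> Y \<Longrightarrow> b \<in> Y \<Longrightarrow> adj s a \<Longrightarrow> adj s b \<Longrightarrow> a \<noteq> b \<Longrightarrow> adj a b"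
      using less(1)[of Y] Y less(2,4) finite_subset[of Y U] unfolding adj_def by blast
    have "adj a b" if ab: "a \<in> U" "b \<in> U" "adj s a" "adj s b" "a \<noteq> b" for a b
    proof -
      \<comment> \<open>Since \<open>s\<close> is far from \<open>W\<close>, its neighbours in
        \<open>U\<close> lie in the clique \<open>X\<close> or in \<open>Y\<close>.\<close>
      have "a \<notin> W" "b \<notin> W" using ab s sym by (auto simp: Y_def far_def)
      then have "a \<in> X \<or> a \<in> Y" "b \<in> X \<or> b \<in> Y" using ab by (auto simp: X_def)
      then show ?thesis using simp_s ab XX XY sym by blast
    qed
    then show ?thesis using s Y unfolding adj_def by blast
  qed
qed

text \<open>Simplicial vertices are removed one at a time; the removed vertex gets rank 0 and the
  ranks of the others move up by one.\<close>

lemma chordal_perfect_elimination_ordering: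
  assumes C: "chordal C" and "finite U" "U \<subseteq> verts C"
  shows "\<exists>r::'a \<Rightarrow> nat. inj_on r U \<and> (\<forall>s\<in>U. \<forall>a\<in>U. \<forall>b\<in>U. {s, a} \<in> edges C \<longrightarrow> {s, b} \<in> edges C \<longrightarrow>
    r s < r a \<longrightarrow> r s < r b \<longrightarrow> a \<noteq> b \<longrightarrow> {a, b} \<in> edges C)"
  using assms(2-)
proof (induction "card U" arbitrary: U)
  case 0
  then show ?case by auto
next
  case (Suc n)
  then have "U \<noteq> {}" by auto
  then obtain s where s: "s \<in> U" "\<forall>a\<in>U. \<forall>b\<in>U. {s, a} \<in> edges C \<longrightarrow> {s, b} \<in> edges C \<longrightarrow> a \<noteq> b \<longrightarrow> {a, b} \<in> edges C"
    using chordal_simplicial_vertex[OF C Suc(3) _ Suc(4)] by blast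
  have "n = card (U - {s})" using Suc(2,3) s(1) by simp
  from Suc(1)[OF this] Suc(3,4) obtain r :: "'a \<Rightarrow> nat" where
    r: "inj_on r (U - {s})" "\<forall>t\<in>U - {s}. \<forall>a\<in>U - {s}. \<forall>b\<in>U - {s}. {t, a} \<in> edges C \<longrightarrow> {t, b} \<in> edges C \<longrightarrow>
    r t < r a \<longrightarrow> r t < r b \<longrightarrow> a \<noteq> b \<longrightarrow> {a, b} \<in> edges C"
    by auto
  show ?case
  proof (intro exI[of _ "\<lambda>v. if v = s then 0 else Suc (r v)"] conjI ballI impI)
    show "inj_on (\<lambda>v. if v = s then 0 else Suc (r v)) U"
      using r(1) by (auto simp: inj_on_def)
  next
    fix t a b
    assume *: "t \<in> U" "a \<in> U" "b \<in> U" "{t, a} \<in> edges C" "{t, b} \<in> edges C"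
      "(if t = s then 0 else Suc (r t)) < (if a = s then 0 else Suc (r a))"
      "(if t = s then 0 else Suc (r t)) < (if b = s then 0 else Suc (r b))" "a \<noteq> b"
    show "{a, b} \<in> edges C"
    proof (cases "t = s")
      case True
      then show ?thesis using s * by blast
    next
      case False
      then have "a \<noteq> s" "b \<noteq> s" using * by (auto split: if_splits)
      then have "t \<in> U - {s}" "a \<in> U - {s}" "b \<in> U - {s}" "r t < r a" "r t < r b"
        using * False by simp_all
      then show ?thesis using r(2) * by blast
    qed
  qed
qed

section \<open>Colouring along a relation of bounded outdegree\<close>

text \<open>Indegrees and outdegrees have the same sum, so some \<open>v\<close> has indegree at
  most \<open>D\<close> too. Once the rest is coloured, its at most \<open>2 * D\<close> neighbours
  leave one of the \<open>2 * D + 1\<close> colours free.\<close>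

lemma bounded_outdegree_colouring:
  fixes R :: "'a \<Rightarrow> 'a \<Rightarrow> bool"
  assumes "finite V" "\<And>v. v \<in> V \<Longrightarrow> card {w \<in> V. R v w} \<le> D"
  shows "\<exists>f::'a \<Rightarrow> nat. f ` V \<subseteq> {..2 * D} \<and> (\<forall>u\<in>V. \<forall>v\<in>V. u \<noteq> v \<longrightarrow> R u v \<longrightarrow> f u \<noteq> f v)"
  using assms
proof (induction "card V" arbitrary: V)
  case 0
  then show ?case by auto
next
  case (Suc n)
  have "\<exists>v\<in>V. card {u \<in> V. R u v} \<le> D"
  proof (rule ccontr)
    assume "\<not> ?thesis"
    then have "\<And>v. v \<in> V \<Longrightarrow> card {u \<in> V. R u v} > D" by auto
    moreover have "V \<noteq> {}" using Suc by auto
    ultimately have "(\<Sum>v\<in>V. D) < (\<Sum>v\<in>V. card {u \<in> V. R u v})"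
      using Suc(3) by (intro sum_strict_mono) auto
    also have "\<dots> = (\<Sum>u\<in>V. card {v \<in> V. R u v})"
      using sum.swap_restrict[of V V "\<lambda>_ _. 1::nat" "\<lambda>v u. R u v"] Suc(3) by simp
    also have "\<dots> \<le> (\<Sum>u\<in>V. D)" using Suc(4) by (intro sum_mono)
    finally show False by simp
  qed
  then obtain v where v: "v \<in> V" "card {u \<in> V. R u v} \<le> D" by blast
  have "card {w \<in> V - {v}. R u w} \<le> D" if "u \<in> V - {v}" for u
    using that Suc(3) by (intro order.trans[OF card_mono Suc(4)[of u]]) auto
  moreover have "n = card (V - {v})" using Suc(2,3) v(1) by simp
  ultimately obtain f :: "'a \<Rightarrow> nat" where f: "f ` (V - {v}) \<subseteq> {..2 * D}"
    "\<forall>a\<in>V - {v}. \<forall>b\<in>V - {v}. a \<noteq> b \<longrightarrow> R a b \<longrightarrow> f a \<noteq> f b"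
    using Suc(1)[of "V - {v}"] Suc(3) by auto
  define N where "N = {u \<in> V. R u v} \<union> {u \<in> V. R v u}"
  have "finite N" using Suc(3) by (simp add: N_def)
  have "card (f ` N) \<le> card N" by (rule card_image_le[OF \<open>finite N\<close>])
  also have "\<dots> \<le> 2 * D"
    using card_Un_le[of "{u \<in> V. R u v}" "{u \<in> V. R v u}"] v Suc(4)[of v] unfolding N_def by simp
  also have "\<dots> < card {..2 * D}" by simp
  finally have "\<not> {..2 * D} \<subseteq> f ` N" using card_mono[of "f ` N" "{..2 * D}"] \<open>finite N\<close> by auto
  then obtain c where c: "c \<le> 2 * D" "c \<notin> f ` N" by auto
  show ?case
  proof (intro exI[of _ "f(v := c)"] conjI)
    show "(f(v := c)) ` V \<subseteq> {..2 * D}" using f(1) c by auto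
    show "\<forall>a\<in>V. \<forall>b\<in>V. a \<noteq> b \<longrightarrow> R a b \<longrightarrow> (f(v := c)) a \<noteq> (f(v := c)) b"
      using f(2) c by (auto simp: N_def)
  qed
qed

section \<open>Orienting edges by a chordal subgraph of the line graph\<close>

text \<open>If both endpoints fail, two distinct edges \<open>{v, a}\<close> and
  \<open>{v, b}\<close> avoid \<open>u\<close>, and some \<open>{u, c}\<close> avoids
  \<open>v\<close>. Intersection forces \<open>a = c\<close> and \<open>b = c\<close>, a
  contradiction.\<close>

lemma pairwise_intersecting_endpoint:
  assumes "u \<noteq> v" "\<And>f. f \<in> N \<Longrightarrow> card f = 2 \<and> f \<inter> {u, v} \<noteq> {} \<and> f \<noteq> {u, v}"
    and "\<And>f g. f \<in> N \<Longrightarrow> g \<in> N \<Longrightarrow> f \<inter> g \<noteq> {}"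
  shows "\<exists>d\<in>{u, v}. \<forall>f\<in>N. \<forall>g\<in>N. d \<notin> f \<longrightarrow> d \<notin> g \<longrightarrow> f = g"
proof (rule ccontr)
  assume "\<not> ?thesis"
  then have "\<exists>f\<in>N. \<exists>g\<in>N. u \<notin> f \<and> u \<notin> g \<and> f \<noteq> g" "\<exists>f\<in>N. \<exists>g\<in>N. v \<notin> f \<and> v \<notin> g \<and> f \<noteq> g"
    by simp_all
  then obtain f g f' g' where *: "f \<in> N" "g \<in> N" "u \<notin> f" "u \<notin> g" "f \<noteq> g"
    "f' \<in> N" "g' \<in> N" "v \<notin> f'" "v \<notin> g'" "f' \<noteq> g'"
    by metis
  have form: "\<exists>w. h = {a, w} \<and> w \<noteq> u \<and> w \<noteq> v" if "h \<in> N" "b \<notin> h" "{a, b} = {u, v}" for h a b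
  proof -
    have h: "card h = 2" "h \<inter> {u, v} \<noteq> {}" "h \<noteq> {u, v}" using assms(2)[OF that(1)] by auto
    have "a \<in> h" using h(2) that(2) unfolding that(3)[symmetric] by blast
    moreover obtain x y where "h = {x, y}" "x \<noteq> y" using h(1) by (auto simp: card_2_iff)
    ultimately obtain w where "w \<noteq> a" and "h = {a, w}"
      by (metis insert_commute insertE singletonD)
    moreover have "w \<noteq> b" using that(2) calculation by auto
    moreover have "u \<in> {a, b}" "v \<in> {a, b}" using that(3) by auto
    ultimately show ?thesis using \<open>w \<noteq> a\<close> by auto
  qed
  obtain a where a: "f = {v, a}" "a \<noteq> u" "a \<noteq> v" using form[of f u v] * by auto
  obtain b where b: "g = {v, b}" "b \<noteq> u" "b \<noteq> v" using form[of g u v] * by auto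
  obtain c where c: "f' = {u, c}" "c \<noteq> u" "c \<noteq> v" using form[of f' v u] * by auto
  obtain d where d: "g' = {u, d}" "d \<noteq> u" "d \<noteq> v" using form[of g' v u] * by auto
  have "a = c" using assms(1) assms(3)[of f f'] * a c by auto
  moreover have "b = c" using assms(1) assms(3)[of g f'] * b c by auto
  ultimately show False using * a b by auto
qed

lemma simple_graph_edges_eqI:
  assumes "simple_graph G" "e \<in> edges G" "f \<in> edges G" "u \<noteq> v" "{u, v} \<subseteq> e" "{u, v} \<subseteq> f"
  shows "e = f"
proof -
  have "card e = 2" "card f = 2" using assms by (auto simp: simple_graph_def)
  then have "e = {u, v}" "f = {u, v}" using assms(4-6) by (auto simp: card_2_iff)
  then show ?thesis by simp
qed

text \<open>\<open>r\<close> ranks a perfect elimination ordering and \<open>d e\<close> is the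
  endpoint towards which \<open>e\<close> is oriented. The final disjunction encodes that at most
  one later neighbour of \<open>e\<close> misses \<open>d e\<close>.\<close>

definition elimination_orientation ::
    "'a ugraph \<Rightarrow> 'a set ugraph \<Rightarrow> ('a set \<Rightarrow> nat) \<Rightarrow> ('a set \<Rightarrow> 'a) \<Rightarrow> bool" where
  "elimination_orientation G C r d \<longleftrightarrow>
     inj_on r (verts C) \<and> (\<forall>e\<in>edges G. d e \<in> e) \<and>
     (\<forall>e f g. {e, f} \<in> edges C \<longrightarrow> {e, g} \<in> edges C \<longrightarrow> r e < r f \<longrightarrow> r e < r g \<longrightarrow> f \<noteq> g \<longrightarrow>
        {f, g} \<in> edges C \<and> (d e \<in> f \<or> d e \<in> g))"

text \<open>The later neighbours of \<open>e\<close> form a clique of \<open>C\<close>, hence are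
  pairwise intersecting edges of \<open>G\<close>, and \<open>pairwise_intersecting_endpoint\<close>
  supplies \<open>d e\<close>.\<close>

lemma elimination_orientation_exists:
  assumes G: "finite_simple_graph G" and C: "chordal C"
    and sub: "verts C \<subseteq> edges G" "edges C \<subseteq> edges (line_graph G)"
  shows "\<exists>r d. elimination_orientation G C r d"
proof -
  have simple: "simple_graph G" using G by (simp add: finite_simple_graph_def)
  have verts: "e \<in> verts C" "f \<in> verts C" if "{e, f} \<in> edges C" for e f
    using that C by (auto simp: chordal_def simple_graph_def)
  have adj: "e \<noteq> f \<and> e \<inter> f \<noteq> {}" if "{e, f} \<in> edges C" for e f
  proof -
    have "{e, f} \<in> edges (line_graph G)" using that sub(2) by blast
    then show ?thesis by (auto simp: line_graph_def doubleton_eq_iff)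
  qed
  have "finite (verts C)" using sub(1) finite_edges[OF G] finite_subset by blast
  from chordal_perfect_elimination_ordering[OF C this order.refl]
  obtain r :: "'a set \<Rightarrow> nat" where inj: "inj_on r (verts C)"
    and ordering: "\<forall>s\<in>verts C. \<forall>a\<in>verts C. \<forall>b\<in>verts C. {s, a} \<in> edges C \<longrightarrow> {s, b} \<in> edges C \<longrightarrow>
      r s < r a \<longrightarrow> r s < r b \<longrightarrow> a \<noteq> b \<longrightarrow> {a, b} \<in> edges C"
    by (elim exE conjE)
  have peo: "{f, g} \<in> edges C"
    if "{e, f} \<in> edges C" "{e, g} \<in> edges C" "r e < r f" "r e < r g" "f \<noteq> g" for e f g
    using ordering that verts[OF that(1)] verts[OF that(2)] by blast
  \<comment> \<open>This also covers edges of \<open>G\<close> outside \<open>verts C\<close>: they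
    have no neighbours in \<open>C\<close>, so any endpoint will do.\<close>
  have "\<exists>d\<in>e. \<forall>f g. {e, f} \<in> edges C \<longrightarrow> {e, g} \<in> edges C \<longrightarrow> r e < r f \<longrightarrow> r e < r g \<longrightarrow> f \<noteq> g \<longrightarrow> d \<in> f \<or> d \<in> g"
    if e: "e \<in> edges G" for e
  proof -
    have "card e = 2" using e simple by (simp add: simple_graph_def)
    then obtain u v where uv: "e = {u, v}" "u \<noteq> v" by (auto simp: card_2_iff)
    define N where "N = {f. {e, f} \<in> edges C \<and> r e < r f}"
    have edge: "f \<in> edges G" "e \<inter> f \<noteq> {}" "e \<noteq> f" if "f \<in> N" for f
    proof -
      have ef: "{e, f} \<in> edges C" using that by (simp add: N_def)
      show "f \<in> edges G" using verts(2)[OF ef] sub(1) by blast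
      show "e \<inter> f \<noteq> {}" "e \<noteq> f" using adj[OF ef] by auto
    qed
    have meets: "card f = 2 \<and> f \<inter> {u, v} \<noteq> {} \<and> f \<noteq> {u, v}" if "f \<in> N" for f
    proof -
      have "card f = 2" using edge(1)[OF that] simple by (simp add: simple_graph_def)
      then show ?thesis using edge(2,3)[OF that] unfolding uv(1) by blast
    qed
    have intersecting: "f \<inter> g \<noteq> {}" if "f \<in> N" "g \<in> N" for f g
    proof (cases "f = g")
      case True
      then show ?thesis using edge[OF that(1)] by auto
    next
      case False
      then show ?thesis using adj[of f g] peo[of e f g] that by (auto simp: N_def)
    qed
    have "\<exists>d\<in>e. \<forall>f\<in>N. \<forall>g\<in>N. d \<notin> f \<longrightarrow> d \<notin> g \<longrightarrow> f = g"
      unfolding uv(1) by (rule pairwise_intersecting_endpoint[OF uv(2) meets intersecting])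
    then obtain d where d: "d \<in> e" "\<forall>f\<in>N. \<forall>g\<in>N. d \<notin> f \<longrightarrow> d \<notin> g \<longrightarrow> f = g" ..
    show ?thesis
    proof (intro bexI[OF _ d(1)] allI impI)
      fix f g
      assume "{e, f} \<in> edges C" "{e, g} \<in> edges C" "r e < r f" "r e < r g" "f \<noteq> g"
      then have "f \<in> N" "g \<in> N" by (simp_all add: N_def)
      then show "d \<in> f \<or> d \<in> g" using d(2) \<open>f \<noteq> g\<close> by blast
    qed
  qed
  then obtain d where d: "\<forall>e\<in>edges G. d e \<in> e \<and> (\<forall>f g. {e, f} \<in> edges C \<longrightarrow> {e, g} \<in> edges C \<longrightarrow>
      r e < r f \<longrightarrow> r e < r g \<longrightarrow> f \<noteq> g \<longrightarrow> d e \<in> f \<or> d e \<in> g)"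
    by metis
  have endpoint: "d e \<in> f \<or> d e \<in> g"
    if "{e, f} \<in> edges C" "{e, g} \<in> edges C" "r e < r f" "r e < r g" "f \<noteq> g" for e f g
  proof -
    have "e \<in> edges G" using verts(1)[OF that(1)] sub(1) by blast
    then show ?thesis using d that by simp
  qed
  have "elimination_orientation G C r d"
    unfolding elimination_orientation_def
  proof (intro conjI allI impI)
    fix e f g
    assume *: "{e, f} \<in> edges C" "{e, g} \<in> edges C" "r e < r f" "r e < r g" "f \<noteq> g"
    show "{f, g} \<in> edges C" by (rule peo[OF *])
    show "d e \<in> f \<or> d e \<in> g" by (rule endpoint[OF *])
  qed (use inj d in simp_all)
  then show ?thesis by blast
qed

text \<open>
  If \<open>a\<close> is oriented away from \<open>v\<close>, it has at most one later neighbour through \<open>v\<close>. Otherwise all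
  edges in \<open>B\<close> are; the later neighbours of \<open>a\<close> in \<open>B\<close> form a clique, and so the first of them has
  at most one later neighbour among the others.
\<close>

lemma card_later_neighbours_le_2:
  assumes simple: "simple_graph G" and or: "elimination_orientation G C r d"
    and C: "simple_graph C" "verts C \<subseteq> edges G"
    and v: "v \<in> a" "\<And>b. b \<in> B \<Longrightarrow> v \<in> b" and "finite B"
    and away: "d a \<noteq> v \<or> (\<forall>b\<in>B. d b \<noteq> v)"
  shows "card {b \<in> B. {a, b} \<in> edges C \<and> r a < r b} \<le> 2"
proof -
  define N where "N = {b \<in> B. {a, b} \<in> edges C \<and> r a < r b}"
  have "finite N" using \<open>finite B\<close> by (simp add: N_def)
  have verts: "e \<in> verts C" "f \<in> verts C" if "{e, f} \<in> edges C" for e f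
    using that C by (auto simp: simple_graph_def)
  \<comment> \<open>Of two distinct later neighbours through \<open>v\<close>, one would also
    contain \<open>d e\<close>. Sharing both endpoints with \<open>e\<close>, it would equal
    \<open>e\<close>, against the strict ranks.\<close>
  have unique: "f = g" if "{e, f} \<in> edges C" "{e, g} \<in> edges C" "r e < r f" "r e < r g"
    "v \<in> e" "v \<in> f" "v \<in> g" "d e \<noteq> v" for e f g
  proof (rule ccontr)
    assume "f \<noteq> g"
    then have "d e \<in> f \<or> d e \<in> g"
      using or that unfolding elimination_orientation_def by blast
    moreover have E: "e \<in> edges G" "f \<in> edges G" "g \<in> edges G" using that verts C(2) by blast+
    moreover have "d e \<in> e" using or E by (auto simp: elimination_orientation_def)
    ultimately have "e = f \<or> e = g"
      using that simple_graph_edges_eqI[OF simple, of e _ "d e" v] by auto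
    then show False using that by auto
  qed
  show ?thesis
  proof (cases "d a \<noteq> v")
    case True
    then have "\<forall>f\<in>N. \<forall>g\<in>N. f = g" using unique v by (auto simp: N_def)
    then have "card N \<le> Suc 0" using \<open>finite N\<close> by (simp add: card_le_Suc0_iff_eq)
    then show ?thesis by (simp add: N_def)
  next
    case False
    show ?thesis
    proof (cases "N = {}")
      case False
      then obtain m where m: "m \<in> N" "\<And>b. b \<in> N \<Longrightarrow> r m \<le> r b"
        using ex_has_least_nat[of "\<lambda>b. b \<in> N" _ r] by auto
      have later: "{m, b} \<in> edges C \<and> r m < r b" if "b \<in> N - {m}" for b
      proof
        show "{m, b} \<in> edges C"
          using that m(1) or by (auto simp: N_def elimination_orientation_def)
        then have "r m \<noteq> r b"
          using that or verts[of m b] by (auto simp: elimination_orientation_def inj_on_def)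
        then show "r m < r b" using m(2)[of b] that by auto
      qed
      have "d m \<noteq> v" "v \<in> m" using away \<open>\<not> d a \<noteq> v\<close> m(1) v by (auto simp: N_def)
      then have "\<forall>f\<in>N - {m}. \<forall>g\<in>N - {m}. f = g"
        using later unique[of m] v(2) by (auto simp: N_def)
      then have "card (N - {m}) \<le> Suc 0" using \<open>finite N\<close> card_le_Suc0_iff_eq[of "N - {m}"] by simp
      then have "card N \<le> 2" using m(1) \<open>finite N\<close> by (simp add: card_Diff_singleton)
      then show ?thesis by (simp add: N_def)
    qed (simp flip: N_def)
  qed
qed

section \<open>Double counting and the bound on the chromatic number\<close>

lemma chromatic_number_le_card:
  assumes "finite X" "c ` verts G \<subseteq> X" "\<And>u v. {u, v} \<in> edges G \<Longrightarrow> c u \<noteq> c v"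
    and "simple_graph G"
  shows "chromatic_number G \<le> card X"
proof -
  obtain h where h: "bij_betw h X {0..<card X}"
    using ex_bij_betw_finite_nat[OF assms(1)] by blast
  have "(h \<circ> c) ` verts G \<subseteq> {..<card X}"
    using bij_betwE[OF h] assms(2) by fastforce
  moreover have "(h \<circ> c) u \<noteq> (h \<circ> c) v" if "{u, v} \<in> edges G" for u v
  proof -
    have "u \<in> verts G" "v \<in> verts G" using that assms(4) by (auto simp: simple_graph_def)
    then have "c u \<in> X" "c v \<in> X" using assms(2) by auto
    then show ?thesis using h assms(3)[OF that] by (auto simp: bij_betw_def inj_on_def)
  qed
  ultimately have "proper_colouring G (card X) (h \<circ> c)" by (simp add: proper_colouring_def)
  then show ?thesis unfolding chromatic_number_def by (blast intro: Least_le)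
qed

text \<open>Each pair in \<open>A \<times> B\<close> is charged to its member in \<open>A\<close> by
  \<open>P\<close> or to its member in \<open>B\<close> by \<open>Q\<close>, and no element is
  charged more than \<open>m\<close> times.\<close>

lemma card_mult_le_if_sparse_both_ways:
  assumes "finite A" "finite B"
    and "\<And>a b. a \<in> A \<Longrightarrow> b \<in> B \<Longrightarrow> P a b \<or> Q b a"
    and "\<And>a. a \<in> A \<Longrightarrow> card {b \<in> B. P a b} \<le> m" "\<And>b. b \<in> B \<Longrightarrow> card {a \<in> A. Q b a} \<le> m"
  shows "card A * card B \<le> m * card A + m * card B"
proof -
  let ?L = "SIGMA a:A. {b \<in> B. P a b}" and ?M = "SIGMA b:B. {a \<in> A. Q b a}"
  have "A \<times> B \<subseteq> ?L \<union> prod.swap ` ?M" using assms(3) by (force simp: image_iff)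
  then have "card (A \<times> B) \<le> card (?L \<union> prod.swap ` ?M)"
    using assms(1,2) by (intro card_mono) auto
  also have "\<dots> \<le> card ?L + card (prod.swap ` ?M)" by (rule card_Un_le)
  also have "card (prod.swap ` ?M) \<le> card ?M" using assms(1,2) by (intro card_image_le) auto
  also have "card ?L = (\<Sum>a\<in>A. card {b \<in> B. P a b})" using assms(1,2) by (intro card_SigmaI) auto
  also have "\<dots> \<le> m * card A"
    using sum_bounded_above[of A "\<lambda>a. card {b \<in> B. P a b}" m] assms(4) by (simp add: mult.commute)
  also have "card ?M = (\<Sum>b\<in>B. card {a \<in> A. Q b a})" using assms(1,2) by (intro card_SigmaI) auto
  also have "\<dots> \<le> m * card B"
    using sum_bounded_above[of B "\<lambda>b. card {a \<in> A. Q b a}" m] assms(5) by (simp add: mult.commute)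
  finally show ?thesis by (simp add: card_cartesian_product)
qed

text \<open>The first factor counts sets of types. The second counts the colours for edges of
  infrequent type: each vertex has at most \<open>4 * k\<close> edges of each of at most
  \<open>2 ^ k\<close> such types.\<close>

lemma chromatic_number_le_chordal_cover:
  assumes G: "finite_simple_graph G" and "finite \<C>" and cover: "chordal_cover (line_graph G) \<C>"
    and k: "k = card \<C>"
  shows "chromatic_number G \<le> 2 ^ 2 ^ k * Suc (2 * (2 ^ k * (4 * k)))"
proof -
  have simple: "simple_graph G" and finV: "finite (verts G)"
    using G by (auto simp: finite_simple_graph_def)
  note finE = finite_edges[OF G]
  have C: "chordal C" "simple_graph C" "verts C \<subseteq> edges G" "edges C \<subseteq> edges (line_graph G)" if "C \<in> \<C>" for C
  proof -
    have "graph_Union \<C> = line_graph G" using cover by (simp add: chordal_cover_def)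
    then have "verts (graph_Union \<C>) = edges G" "edges (graph_Union \<C>) = edges (line_graph G)"
      by (simp_all add: line_graph_def)
    then show "verts C \<subseteq> edges G" "edges C \<subseteq> edges (line_graph G)"
      using that by (auto simp: graph_Union_def)
    show "chordal C" using cover that by (auto simp: chordal_cover_def)
    then show "simple_graph C" by (simp add: chordal_def)
  qed
  have covered: "\<exists>C\<in>\<C>. {a, b} \<in> edges C"
    if "a \<in> edges G" "b \<in> edges G" "a \<noteq> b" "v \<in> a" "v \<in> b" for a b v
  proof -
    have "{a, b} \<in> edges (line_graph G)" using that by (auto simp: line_graph_def)
    then have "{a, b} \<in> edges (graph_Union \<C>)" using cover by (simp add: chordal_cover_def)
    then show ?thesis by (auto simp: graph_Union_def)
  qed
  have "\<forall>C\<in>\<C>. \<exists>rd. elimination_orientation G C (fst rd) (snd rd)"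
    using elimination_orientation_exists[OF G] C by force
  then obtain rd where "\<forall>C\<in>\<C>. elimination_orientation G C (fst (rd C)) (snd (rd C))"
    by metis
  then obtain r d where or: "\<And>C. C \<in> \<C> \<Longrightarrow> elimination_orientation G C (r C) (d C)"
    by (auto intro: that[of "\<lambda>C. fst (rd C)" "\<lambda>C. snd (rd C)"])
  define T where "T v e = {C \<in> \<C>. d C e = v}" for v e
  define A where "A v S = {e \<in> edges G. v \<in> e \<and> T v e = S}" for v S
  define heavy where "heavy v = {S. S \<subseteq> \<C> \<and> card (A v S) > 4 * k}" for v
  have finA: "finite (A v S)" for v S using finE by (simp add: A_def)
  define before where "before a b \<longleftrightarrow> (\<exists>C\<in>\<C>. {a, b} \<in> edges C \<and> r C a < r C b)" for a b
  have sparse: "card {b \<in> A v S'. before a b} \<le> 2 * k"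
    if a: "a \<in> A v S" and S: "S \<inter> S' = {}" for a v S S'
  proof -
    have "{b \<in> A v S'. before a b} = (\<Union>C\<in>\<C>. {b \<in> A v S'. {a, b} \<in> edges C \<and> r C a < r C b})"
      by (auto simp: before_def)
    then have "card {b \<in> A v S'. before a b} \<le> (\<Sum>C\<in>\<C>. card {b \<in> A v S'. {a, b} \<in> edges C \<and> r C a < r C b})"
      using card_UN_le[OF \<open>finite \<C>\<close>] by simp
    also have "\<dots> \<le> (\<Sum>C\<in>\<C>. 2)"
    proof (rule sum_mono)
      fix C assume CC: "C \<in> \<C>"
      \<comment> \<open>If \<open>C\<close> orients \<open>a\<close> into \<open>v\<close>, then
        \<open>C\<close> lies in \<open>S\<close>, hence not in \<open>S'\<close>, so no edge of
        \<open>A v S'\<close> is oriented into \<open>v\<close> by \<open>C\<close>.\<close>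
      have "d C a \<noteq> v \<or> (\<forall>b\<in>A v S'. d C b \<noteq> v)"
        using a S CC by (auto simp: A_def T_def)
      then show "card {b \<in> A v S'. {a, b} \<in> edges C \<and> r C a < r C b} \<le> 2"
        using a by (intro card_later_neighbours_le_2[OF simple or[OF CC] C(2,3)[OF CC] _ _ finA, of v])
          (auto simp: A_def)
    qed
    finally show ?thesis by (simp add: k)
  qed
  have heavy_compl: "\<C> - S \<notin> heavy v" if S: "S \<in> heavy v" for S v
  proof
    assume S': "\<C> - S \<in> heavy v"
    let ?A = "A v S" and ?B = "A v (\<C> - S)"
    have gt: "card ?A > 4 * k" "card ?B > 4 * k" using S S' by (auto simp: heavy_def)
    have "before a b \<or> before b a" if ab: "a \<in> ?A" "b \<in> ?B" for a b
    proof -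
      \<comment> \<open>For an empty cover \<open>S\<close> and its complement would coincide. A
        member exists because \<open>a\<close> is a vertex of the line graph; it then separates the
        types of \<open>a\<close> and \<open>b\<close>.\<close>
      obtain C0 where "C0 \<in> \<C>"
      proof -
        have "a \<in> verts (line_graph G)" using ab by (simp add: A_def line_graph_def)
        then have "a \<in> verts (graph_Union \<C>)" using cover by (simp add: chordal_cover_def)
        then show thesis using that by (auto simp: graph_Union_def)
      qed
      then have "a \<noteq> b" using ab by (auto simp: A_def)
      then obtain C where CC: "C \<in> \<C>" "{a, b} \<in> edges C"
        using covered[of a b v] ab by (auto simp: A_def)
      then have "a \<in> verts C" "b \<in> verts C" using C(2)[OF CC(1)] by (auto simp: simple_graph_def)
      then have "r C a \<noteq> r C b"
        using or[OF CC(1)] \<open>a \<noteq> b\<close> by (auto simp: elimination_orientation_def inj_on_def)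
      moreover have "{b, a} \<in> edges C" using CC(2) by (simp add: insert_commute)
      ultimately show ?thesis using CC unfolding before_def by (meson linorder_neqE_nat)
    qed
    then have "card ?A * card ?B \<le> 2 * k * card ?A + 2 * k * card ?B"
      by (intro card_mult_le_if_sparse_both_ways[where P = before and Q = before])
        (auto intro!: finA sparse)
    \<comment> \<open>Adding the two lower bounds gives \<open>2 * card ?A * card ?B\<close> at
      least \<open>4 * k * (card ?A + card ?B)\<close> plus a positive term, while twice the upper
      bound lacks that term.\<close>
    moreover have "(4 * k) * card ?B + card ?B \<le> card ?A * card ?B"
      using mult_le_mono1[of "Suc (4 * k)" "card ?A" "card ?B"] gt(1) by simp
    moreover have "(4 * k) * card ?A + card ?A \<le> card ?A * card ?B"
      using mult_le_mono1[of "Suc (4 * k)" "card ?B" "card ?A"] gt(2) by (simp add: mult.commute)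
    ultimately show False using gt by simp
  qed
  define D where "D = 2 ^ k * (4 * k)"
  \<comment> \<open>An edge may be light at one end only. The bound is on the outdegree of
    \<open>light\<close>, which is what \<open>bounded_outdegree_colouring\<close> asks for.\<close>
  define light where "light u w \<longleftrightarrow> {u, w} \<in> edges G \<and> T u {u, w} \<notin> heavy u" for u w
  have outdeg: "card {w \<in> verts G. light u w} \<le> D" for u
  proof -
    have "inj_on (\<lambda>w. {u, w}) {w \<in> verts G. light u w}"
      by (auto simp: inj_on_def doubleton_eq_iff)
    then have "card {w \<in> verts G. light u w} = card ((\<lambda>w. {u, w}) ` {w \<in> verts G. light u w})"
      by (simp add: card_image)
    also have "\<dots> \<le> card (\<Union>S\<in>Pow \<C> - heavy u. A u S)"
      using \<open>finite \<C>\<close> finA by (intro card_mono) (auto simp: light_def A_def T_def)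
    also have "\<dots> \<le> (\<Sum>S\<in>Pow \<C> - heavy u. card (A u S))"
      using \<open>finite \<C>\<close> by (intro card_UN_le) auto
    also have "\<dots> \<le> (\<Sum>S\<in>Pow \<C> - heavy u. 4 * k)"
      by (intro sum_mono) (auto simp: heavy_def)
    also have "\<dots> \<le> card (Pow \<C>) * (4 * k)"
      using \<open>finite \<C>\<close> card_mono[of "Pow \<C>" "Pow \<C> - heavy u"] by simp
    finally show ?thesis using \<open>finite \<C>\<close> by (simp add: D_def k card_Pow)
  qed
  obtain f :: "'a \<Rightarrow> nat" where f: "f ` verts G \<subseteq> {..2 * D}"
    "\<forall>u\<in>verts G. \<forall>v\<in>verts G. u \<noteq> v \<longrightarrow> light u v \<longrightarrow> f u \<noteq> f v"
    using bounded_outdegree_colouring[of "verts G" light D, OF finV] outdeg by metis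
  define X where "X = Pow (Pow \<C>) \<times> {..2 * D}"
  have "chromatic_number G \<le> card X"
  proof (rule chromatic_number_le_card[OF _ _ _ simple])
    show "finite X" using \<open>finite \<C>\<close> by (simp add: X_def)
    show "(\<lambda>v. (heavy v, f v)) ` verts G \<subseteq> X"
      using f(1) by (auto simp: X_def heavy_def)
    fix u v assume e: "{u, v} \<in> edges G"
    then have uv: "u \<in> verts G" "v \<in> verts G" "u \<noteq> v"
      using simple by (auto simp: simple_graph_def)
    have e': "{v, u} \<in> edges G" using e by (simp add: insert_commute)
    show "(heavy u, f u) \<noteq> (heavy v, f v)"
    proof
      assume eq: "(heavy u, f u) = (heavy v, f v)"
      then have "\<not> light u v" "\<not> light v u" using f(2)[rule_format, of u v] f(2)[rule_format, of v u] uv by auto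
      then have "T u {u, v} \<in> heavy u" "T v {u, v} \<in> heavy u"
        using e e' eq by (auto simp: light_def insert_commute)
      \<comment> \<open>Each member of the cover orients the edge towards exactly one of its two
        ends.\<close>
      moreover have "T v {u, v} = \<C> - T u {u, v}"
        using or e uv(3) by (fastforce simp: T_def elimination_orientation_def)
      ultimately show False using heavy_compl by metis
    qed
  qed
  also have "card X = 2 ^ 2 ^ k * Suc (2 * D)"
    using \<open>finite \<C>\<close> by (simp add: X_def card_cartesian_product card_Pow k)
  finally show ?thesis by (simp add: D_def)
qed

text \<open>The bound of \<open>chromatic_number_le_chordal_cover\<close> increases with
  \<open>k\<close>, so a cover by at most \<open>M\<close> chordal graphs keeps the chromatic number
  below a constant that it eventually exceeds.\<close>

theorem theorem7:
  fixes G :: "nat \<Rightarrow> 'a ugraph"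
  assumes "\<And>n. n \<ge> 1 \<Longrightarrow> finite_simple_graph (G n)"
    and "filterlim (\<lambda>n. chromatic_number (G n)) at_top sequentially"
  shows "filterlim (\<lambda>n. chordal_covering_number (line_graph (G n))) at_top sequentially"
  unfolding filterlim_at_top
proof
  fix M :: nat
  define bound :: "nat \<Rightarrow> nat" where "bound k = 2 ^ 2 ^ k * Suc (2 * (2 ^ k * (4 * k)))" for k
  have mono: "bound k \<le> bound M" if "k \<le> M" for k
    unfolding bound_def using that
    by (intro mult_le_mono Suc_le_mono[THEN iffD2] power_increasing le_refl) auto
  have "\<forall>\<^sub>F n in sequentially. chromatic_number (G n) \<ge> Suc (bound M)"
    using assms(2) by (simp add: filterlim_at_top)
  \<comment> \<open>Indices from 1 on are selected because finiteness and simplicity of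
    \<open>G n\<close> are assumed only there.\<close>
  then show "\<forall>\<^sub>F n in sequentially. M \<le> chordal_covering_number (line_graph (G n))"
    using eventually_ge_at_top[of 1]
  proof eventually_elim
    case (elim n)
    obtain \<C> where \<C>: "finite \<C>" "card \<C> = chordal_covering_number (line_graph (G n))"
      "chordal_cover (line_graph (G n)) \<C>"
      using chordal_covering_number_attained[OF finite_simple_line_graph[OF assms(1)[OF elim(2)]]]
      by blast
    have "chromatic_number (G n) \<le> bound (card \<C>)"
      unfolding bound_def
      by (rule chromatic_number_le_chordal_cover[OF assms(1)[OF elim(2)] \<C>(1,3) refl])
    then have "\<not> card \<C> \<le> M" using mono[of "card \<C>"] elim(1) by linarith
    then show ?case using \<C>(2) by linarith
  qed
qed

end
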